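(* Let $G$ be a simple connected graph with $n\geq 3$ vertices and $m$ edges. Let $n_i$ denote the number of vertices of $G$ with edge neighborhood degree $i$, and let $\delta$ and $\Delta$ denote the minimum and maximum edge neighborhood degrees of $G$, respectively. Let $M_1=M_1(G)$. Assume that $\Delta-\delta\geq 2$ and $2M_1-4m-n\delta=q(\Delta-\delta)+r$, where $q$ is a positive integer and $r$ is an integer such that $0\leq r\leq\Delta-\delta-1$. Let $a\in\mathbb{R}\setminus\{0,1\}$ and set $s_a=\frac{\Delta^a-\delta^a}{\Delta-\delta}$. Then the following statements hold. (1) If $r=0$ and $n_\Delta=q$, then $G$ is a bi-edge-neighborhood-degree graph whose vertices have edge neighborhood degrees $\delta$ and $\Delta$ (that is, every vertex of $G$ has edge neighborhood degree $\delta$ or $\Delta$). (2) If $r\geq 1$ and $n_\Delta=q$, then $n_i=0$ for $\delta+r+1\leq i\leq\Delta-1$ and $n_{\delta+r}\leq 1$. (3) If $r\geq 1$, either $a<0$ or $a>1$, and $n_{\delta+r}\neq 0$, then \[KB^a(G)\leq n\delta^a+(2M_1-4m-n\delta)s_a+(\delta+r)^a-\delta^a-rs_a.\] (4) If $r\geq 1$, $0<a<1$, and $n_{\delta+r}\neq 0$, then \[KB^a(G)\geq n\delta^a+(2M_1-4m-n\delta)s_a+(\delta+r)^a-\delta^a-rs_a.\] (5) If $r\geq 1$, $a>1$, and $n_{\delta+r}\neq 0$, then \[\ln\left[\prod_{v\in V(G)}S_e(v)^a\right]\geq a\left[n\ln\delta+\frac{(2M_1-4m-n\delta)(\ln\Delta-\ln\delta)}{\Delta-\delta}+\ln(\delta+r)-\ln\delta-r\,\frac{\ln\Delta-\ln\delta}{\Delta-\delta}\right].\]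 In parts (3)--(5), equality holds if $G$ has $q$ vertices of edge neighborhood degree $\Delta$, one vertex of edge neighborhood degree $\delta+r$, and $n-q-1$ vertices of edge neighborhood degree $\delta$.
   Context: Graphs are finite. For a simple graph $G$ with vertex set $V(G)$ and edge set $E(G)$, $d(u)$ denotes the degree of a vertex $u$. The degree of an edge $e=uv$ is $d_G(e)=d(u)+d(v)-2$. The edge neighborhood degree $S_e(v)$ of a vertex $v$ is the sum of the degrees $d_G(e)$ of all edges $e$ incident to $v$. The first Zagreb index is $M_1(G)=\sum_{u\in V(G)}d(u)^2$. For real $a\neq 0,1$, the general Kulli-Basava index is $KB^a(G)=\sum_{v\in V(G)}S_e(v)^a$, and the general multiplicative Kulli-Basava index is $\prod_{v\in V(G)}S_e(v)^a$. *)

theory Defs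
  imports Complex_Main
begin

text \<open>A graph is given by its vertex set and its set of edges, an edge being a two-element set
  of vertices.\<close>

definition simple_graph :: "'a set \<Rightarrow> 'a set set \<Rightarrow> bool" where
  "simple_graph V E \<longleftrightarrow> finite V \<and> (\<forall>e\<in>E. e \<subseteq> V \<and> card e = 2)"

definition connected_graph :: "'a set \<Rightarrow> 'a set set \<Rightarrow> bool" where
  "connected_graph V E \<longleftrightarrow> V \<noteq> {} \<and> (\<forall>u\<in>V. \<forall>v\<in>V. (u, v) \<in> {(x, y). {x, y} \<in> E}\<^sup>*)"

definition degree :: "'a set set \<Rightarrow> 'a \<Rightarrow> nat" where
  "degree E v = card {e\<in>E. v \<in> e}"

text \<open>For an edge \<open>e = {u, v}\<close> this is \<open>d(u) + d(v) - 2\<close>. The subtraction on natural numbers does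
  not truncate, since both ends of an edge of a finite graph have degree at least 1.\<close>

definition edge_degree :: "'a set set \<Rightarrow> 'a set \<Rightarrow> nat" where
  "edge_degree E e = (\<Sum>u\<in>e. degree E u) - 2"

lemma edge_degree_doubleton:
  "u \<noteq> v \<Longrightarrow> edge_degree E {u, v} = degree E u + degree E v - 2"
  by (simp add: edge_degree_def)

definition edge_nbhd_degree :: "'a set set \<Rightarrow> 'a \<Rightarrow> nat" where
  "edge_nbhd_degree E v = (\<Sum>e | e \<in> E \<and> v \<in> e. edge_degree E e)"

definition num_edge_nbhd_degree :: "'a set \<Rightarrow> 'a set set \<Rightarrow> nat \<Rightarrow> nat" where
  "num_edge_nbhd_degree V E i = card {v\<in>V. edge_nbhd_degree E v = i}"

definition min_edge_nbhd_degree :: "'a set \<Rightarrow> 'a set set \<Rightarrow> nat" where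
  "min_edge_nbhd_degree V E = Min (edge_nbhd_degree E ` V)"

definition max_edge_nbhd_degree :: "'a set \<Rightarrow> 'a set set \<Rightarrow> nat" where
  "max_edge_nbhd_degree V E = Max (edge_nbhd_degree E ` V)"

definition first_zagreb :: "'a set \<Rightarrow> 'a set set \<Rightarrow> nat" where
  "first_zagreb V E = (\<Sum>u\<in>V. (degree E u)\<^sup>2)"

definition kulli_basava :: "real \<Rightarrow> 'a set \<Rightarrow> 'a set set \<Rightarrow> real" where
  "kulli_basava a V E = (\<Sum>v\<in>V. real (edge_nbhd_degree E v) powr a)"

definition mult_kulli_basava :: "real \<Rightarrow> 'a set \<Rightarrow> 'a set set \<Rightarrow> real" where
  "mult_kulli_basava a V E = (\<Prod>v\<in>V. real (edge_nbhd_degree E v) powr a)"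

definition bi_edge_nbhd_degree_graph :: "'a set \<Rightarrow> 'a set set \<Rightarrow> nat \<Rightarrow> nat \<Rightarrow> bool" where
  "bi_edge_nbhd_degree_graph V E i j \<longleftrightarrow>
     (\<forall>v\<in>V. edge_nbhd_degree E v = i \<or> edge_nbhd_degree E v = j)"

end

theory Submission
  imports Defs "HOL-Analysis.Convex"
begin

text \<open>Only three properties of the edge neighborhood degrees \<open>S\<^sub>e(v)\<close> matter. They add up to
  \<open>2 * M1 - 4 * m\<close>, because each edge contributes its degree once at each end
  (\<open>sum_edge_nbhd_degree\<close>); they lie between \<open>\<delta>\<close> and \<open>\<Delta>\<close>; and they are positive when the graph is
  connected with at least three vertices (\<open>edge_nbhd_degree_pos\<close>). Hence the excesses
  \<open>S\<^sub>e(v) - \<delta>\<close> lie between \<open>0\<close> and \<open>\<Delta> - \<delta>\<close> and add up to \<open>q * (\<Delta> - \<delta>) + r\<close>.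

  If exactly \<open>q\<close> vertices have the full excess \<open>\<Delta> - \<delta>\<close>, the remaining vertices share the total
  excess \<open>r\<close> (\<open>sum_excess_below_max\<close>). None of them can exceed \<open>r\<close>, and if \<open>r > 0\<close>, at most one of
  them can attain it; this gives the first two parts.

  The three inequalities are one fact about a convex function \<open>f\<close> on the interval from \<open>\<delta>\<close> to
  \<open>\<Delta>\<close>. Such a function lies below its secant, and the secant, being affine, has a sum over the
  vertices that depends only on the number of vertices and the sum of the degrees. The bound is
  improved by evaluating \<open>f\<close> exactly at one vertex of degree \<open>\<delta> + r\<close>. The gap between the two
  sides is then the sum of the vertical distances to the secant over the other vertices
  (\<open>secant_gap\<close>), so it is nonnegative, and it vanishes when all the other vertices have degree
  \<open>\<delta>\<close> or \<open>\<Delta>\<close>, where the secant meets the graph of \<open>f\<close>. For concave \<open>f\<close> the inequality is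
  reversed. The power function with exponent \<open>a\<close> is convex on the positive reals for \<open>a < 0\<close>
  and \<open>a > 1\<close>, and concave for \<open>0 < a < 1\<close>; the logarithm is concave, and the logarithm of the product of the \<open>S\<^sub>e(v)\<^sup>a\<close> is \<open>a\<close> times the
  sum of the \<open>ln S\<^sub>e(v)\<close>. The positivity of \<open>\<delta>\<close> is what makes these facts applicable.\<close>

section \<open>Edge neighborhood degrees of a graph\<close>

lemma simple_graph_finite_edges:
  assumes "simple_graph V E" shows "finite E"
proof -
  have "E \<subseteq> Pow V" "finite V" using assms by (auto simp: simple_graph_def)
  then show ?thesis by (meson finite_Pow_iff finite_subset)
qed

lemma sum_incident_swap:
  fixes h :: "'a \<Rightarrow> 'a set \<Rightarrow> 'b::comm_monoid_add"
  assumes "simple_graph V E"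
  shows "(\<Sum>v\<in>V. \<Sum>e | e \<in> E \<and> v \<in> e. h v e) = (\<Sum>e\<in>E. \<Sum>v\<in>e. h v e)"
proof -
  have fin: "finite V" and sub: "\<And>e. e \<in> E \<Longrightarrow> e \<subseteq> V" using assms by (auto simp: simple_graph_def)
  have "(\<Sum>v\<in>V. \<Sum>e | e \<in> E \<and> v \<in> e. h v e) = (\<Sum>e\<in>E. \<Sum>v | v \<in> V \<and> v \<in> e. h v e)"
    by (rule sum.swap_restrict[OF fin simple_graph_finite_edges[OF assms]])
  also have "\<dots> = (\<Sum>e\<in>E. \<Sum>v\<in>e. h v e)"
    using sub by (intro sum.cong) auto
  finally show ?thesis .
qed

lemma degree_pos:
  assumes "simple_graph V E" and "e \<in> E" and "v \<in> e"
  shows "degree E v \<ge> 1"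
proof -
  have "{e \<in> E. v \<in> e} \<noteq> {}" using assms by auto
  then have "card {e \<in> E. v \<in> e} > 0"
    using simple_graph_finite_edges[OF assms(1)] by (simp add: card_gt_0_iff)
  then show ?thesis by (simp add: degree_def)
qed

lemma int_edge_degree:
  assumes "simple_graph V E" and "e \<in> E"
  shows "int (edge_degree E e) = (\<Sum>u\<in>e. int (degree E u)) - 2"
proof -
  have "(\<Sum>u\<in>e. degree E u) \<ge> (\<Sum>u\<in>e. 1)"
    using degree_pos[OF assms] by (intro sum_mono)
  moreover have "card e = 2" using assms by (simp add: simple_graph_def)
  ultimately show ?thesis by (simp add: edge_degree_def of_nat_diff)
qed

text \<open>Double counting, used twice: summing \<open>d(e)\<close> over incident pairs counts each edge degree
  twice, and summing \<open>d(u)\<close> over incident pairs gives each vertex the weight \<open>d(u)\<^sup>2\<close>.\<close>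

lemma sum_edge_nbhd_degree:
  assumes "simple_graph V E"
  shows "(\<Sum>v\<in>V. int (edge_nbhd_degree E v)) = 2 * int (first_zagreb V E) - 4 * int (card E)"
proof -
  have two: "card e = 2" if "e \<in> E" for e using that assms by (simp add: simple_graph_def)
  have "(\<Sum>e\<in>E. \<Sum>u\<in>e. int (degree E u)) = (\<Sum>v\<in>V. \<Sum>e | e \<in> E \<and> v \<in> e. int (degree E v))"
    by (rule sum_incident_swap[OF assms, symmetric])
  also have "\<dots> = int (first_zagreb V E)"
    by (simp add: first_zagreb_def degree_def power2_eq_square)
  finally have zagreb: "(\<Sum>e\<in>E. \<Sum>u\<in>e. int (degree E u)) = int (first_zagreb V E)" .
  have "(\<Sum>v\<in>V. int (edge_nbhd_degree E v)) = (\<Sum>v\<in>V. \<Sum>e | e \<in> E \<and> v \<in> e. int (edge_degree E e))"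
    by (simp add: edge_nbhd_degree_def)
  also have "\<dots> = (\<Sum>e\<in>E. \<Sum>v\<in>e. int (edge_degree E e))"
    by (rule sum_incident_swap[OF assms])
  also have "\<dots> = (\<Sum>e\<in>E. 2 * ((\<Sum>u\<in>e. int (degree E u)) - 2))"
    using two int_edge_degree[OF assms] by (intro sum.cong) auto
  also have "\<dots> = 2 * int (first_zagreb V E) - 4 * int (card E)"
    by (simp add: zagreb sum_subtractf flip: sum_distrib_left)
  finally show ?thesis .
qed

lemma connected_graph_cut_edge:
  assumes "connected_graph V E" and "u \<in> A" "u \<in> V" and "w \<in> V" "w \<notin> A"
  obtains x y where "x \<in> A" "y \<notin> A" "{x, y} \<in> E"
proof -
  have "(u, w) \<in> {(x, y). {x, y} \<in> E}\<^sup>*" using assms by (simp add: connected_graph_def)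
  then have "w \<notin> A \<longrightarrow> (\<exists>x y. x \<in> A \<and> y \<notin> A \<and> {x, y} \<in> E)"
    by (induction rule: rtrancl_induct) (use assms(2) in auto)
  then show ?thesis using assms(5) that by blast
qed

text \<open>A vertex \<open>v\<close> lies on some edge \<open>{v, w}\<close>, and since a third vertex has to be reached, another
  edge leaves \<open>{v, w}\<close>. That edge raises the degree of \<open>{v, w}\<close> above \<open>0\<close>.\<close>

lemma edge_nbhd_degree_pos:
  assumes G: "simple_graph V E" and con: "connected_graph V E"
    and three: "card V \<ge> 3" and v: "v \<in> V"
  shows "edge_nbhd_degree E v > 0"
proof -
  have finE: "finite E" by (rule simple_graph_finite_edges[OF G])
  have outside: "\<exists>x\<in>V. x \<notin> A" if "card A \<le> 2" "finite A" for A
  proof (rule ccontr)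
    assume "\<not> ?thesis"
    then have "card V \<le> card A" using that by (intro card_mono) auto
    then show False using that three by simp
  qed
  obtain z where "z \<in> V" "z \<notin> {v}" using outside[of "{v}"] by auto
  then obtain w where vw: "w \<noteq> v" "{v, w} \<in> E"
    using connected_graph_cut_edge[OF con, of v "{v}" z] v by auto
  obtain z' where "z' \<in> V" "z' \<notin> {v, w}" using outside[of "{v, w}"] vw by auto
  then obtain x y where xy: "x \<in> {v, w}" "y \<notin> {v, w}" "{x, y} \<in> E"
    using connected_graph_cut_edge[OF con, of v "{v, w}" z'] v by auto
  have "card {{v, w}, {x, y}} \<le> card {e \<in> E. x \<in> e}"
    using finE xy vw by (intro card_mono) auto
  moreover have "{v, w} \<noteq> {x, y}" using xy by auto
  ultimately have "degree E x \<ge> 2" by (simp add: degree_def)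
  moreover have "degree E v \<ge> 1" "degree E w \<ge> 1" using degree_pos[OF G vw(2)] by auto
  ultimately have "degree E v + degree E w \<ge> 3" using xy(1) by auto
  then have "edge_degree E {v, w} > 0" using vw by (simp add: edge_degree_doubleton)
  also have "edge_degree E {v, w} \<le> edge_nbhd_degree E v"
    unfolding edge_nbhd_degree_def using finE vw by (intro member_le_sum) auto
  finally show ?thesis .
qed

section \<open>Distributing the excess over the minimum\<close>

text \<open>The \<open>q\<close> vertices of degree \<open>D\<close> use up exactly the part \<open>q * (D - d)\<close> of the total excess.\<close>

lemma sum_excess_below_max:
  fixes S :: "'a \<Rightarrow> nat"
  assumes fin: "finite V" and ge: "\<And>v. v \<in> V \<Longrightarrow> d \<le> S v"
    and total: "(\<Sum>v\<in>V. int (S v)) - int (card V) * int d = int q * (int D - int d) + int r"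
    and top: "card {v \<in> V. S v = D} = q"
  shows "(\<Sum>v | v \<in> V \<and> S v \<noteq> D. S v - d) = r"
proof -
  have "int q * (int D - int d) + int r = (\<Sum>v\<in>V. int (S v) - int d)"
    using total by (simp add: sum_subtractf)
  also have "\<dots> = (\<Sum>v | v \<in> V \<and> S v = D. int (S v) - int d)
      + (\<Sum>v | v \<in> V \<and> S v \<noteq> D. int (S v) - int d)"
    using sum.Int_Diff[OF fin, of "\<lambda>v. int (S v) - int d" "{v. S v = D}"]
    by (simp add: Int_def set_diff_eq)
  also have "(\<Sum>v | v \<in> V \<and> S v = D. int (S v) - int d) = int q * (int D - int d)"
    using top by simp
  also have "(\<Sum>v | v \<in> V \<and> S v \<noteq> D. int (S v) - int d)
      = int (\<Sum>v | v \<in> V \<and> S v \<noteq> D. S v - d)"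
    using ge by (simp add: of_nat_diff)
  finally show ?thesis by linarith
qed

section \<open>Sums of a convex function and its secant\<close>

text \<open>The secant of \<open>f\<close> through the points at \<open>d\<close> and \<open>D\<close>, summed over \<open>V\<close>, with its value at one
  vertex of degree \<open>d + r\<close> exchanged for the value of \<open>f\<close>.\<close>

definition secant_sum :: "(real \<Rightarrow> real) \<Rightarrow> real \<Rightarrow> real \<Rightarrow> real \<Rightarrow> real \<Rightarrow> real \<Rightarrow> real" where
  "secant_sum f d D r n T =
     n * f d + (T - n * d) * ((f D - f d) / (D - d)) + f (d + r) - f d
       - r * ((f D - f d) / (D - d))"

text \<open>Both the inequalities and their equality case are read off from the right-hand side. The
  vertex \<open>w\<close> drops out of it because \<open>secant_sum\<close> contains the value of \<open>f\<close> there.\<close>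

lemma secant_gap:
  fixes S :: "'a \<Rightarrow> real"
  assumes "finite V" and "w \<in> V" and "S w = d + r"
  shows "secant_sum f d D r (card V) (\<Sum>v\<in>V. S v) - (\<Sum>v\<in>V. f (S v))
    = (\<Sum>v\<in>V - {w}. f d + (f D - f d) / (D - d) * (S v - d) - f (S v))"
proof -
  define t where "t = (f D - f d) / (D - d)"
  have "(\<Sum>v\<in>V. f d + t * (S v - d) - f (S v))
      = real (card V) * f d + t * ((\<Sum>v\<in>V. S v) - real (card V) * d) - (\<Sum>v\<in>V. f (S v))"
    by (simp add: sum_subtractf sum.distrib flip: sum_distrib_left)
  moreover have "(\<Sum>v\<in>V. f d + t * (S v - d) - f (S v))
      = f d + t * r - f (d + r) + (\<Sum>v\<in>V - {w}. f d + t * (S v - d) - f (S v))"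
    using assms by (simp add: sum.remove)
  ultimately show ?thesis
    by (simp add: secant_sum_def algebra_simps flip: t_def)
qed

lemma convex_sum_le_secant_sum:
  fixes S :: "'a \<Rightarrow> real"
  assumes "finite V" and "w \<in> V" and "S w = d + r"
    and range: "\<And>v. v \<in> V \<Longrightarrow> S v \<in> {d..D}" and f: "convex_on {d..D} f"
  shows "(\<Sum>v\<in>V. f (S v)) \<le> secant_sum f d D r (card V) (\<Sum>v\<in>V. S v)"
proof -
  have "(\<Sum>v\<in>V - {w}. f d + (f D - f d) / (D - d) * (S v - d) - f (S v)) \<ge> 0"
    using convex_onD_Icc'[OF f] range by (intro sum_nonneg) (simp add: add.commute)
  then show ?thesis by (simp only: secant_gap[of V w S, OF assms(1-3), symmetric])
qed

lemma concave_sum_ge_secant_sum: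
  fixes S :: "'a \<Rightarrow> real"
  assumes "finite V" and "w \<in> V" and "S w = d + r"
    and range: "\<And>v. v \<in> V \<Longrightarrow> S v \<in> {d..D}" and f: "concave_on {d..D} f"
  shows "(\<Sum>v\<in>V. f (S v)) \<ge> secant_sum f d D r (card V) (\<Sum>v\<in>V. S v)"
proof -
  have "(\<Sum>v\<in>V - {w}. f d + (f D - f d) / (D - d) * (S v - d) - f (S v)) \<le> 0"
    using concave_onD_Icc'[OF f] range by (intro sum_nonpos) (simp add: add.commute)
  then show ?thesis by (simp only: secant_gap[of V w S, OF assms(1-3), symmetric])
qed

text \<open>The three counts add up to the number of vertices, so apart from the one vertex of degree
  \<open>d + r\<close> every vertex sits at an end of the interval, where the gap to the secant is \<open>0\<close>.\<close>

lemma sum_eq_secant_sum: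
  fixes S :: "'a \<Rightarrow> nat"
  assumes fin: "finite V" and r: "1 \<le> r" "d + r < D"
    and cD: "card {v \<in> V. S v = D} = q" and cr: "card {v \<in> V. S v = d + r} = 1"
    and cd: "int (card {v \<in> V. S v = d}) = int (card V) - int q - 1"
  shows "(\<Sum>v\<in>V. f (real (S v))) = secant_sum f d D r (card V) (\<Sum>v\<in>V. real (S v))"
proof -
  let ?X = "\<lambda>i. {v \<in> V. S v = i}"
  obtain w where w: "?X (d + r) = {w}" using cr by (auto simp: card_1_singleton_iff)
  have "card (?X d \<union> ?X (d + r) \<union> ?X D) = card (?X d) + card (?X (d + r)) + card (?X D)"
    using fin r by (subst card_Un_disjoint; (subst card_Un_disjoint)?) auto
  also have "\<dots> = card V" using cD cr cd by simp
  finally have "?X d \<union> ?X (d + r) \<union> ?X D = V" using fin by (intro card_subset_eq) auto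
  then have ends: "S v = d \<or> S v = D" if "v \<in> V - {w}" for v using that w by auto
  have "(\<Sum>v\<in>V - {w}. f d + (f D - f d) / (real D - real d) * (real (S v) - d) - f (real (S v))) = 0"
    using ends r by (intro sum.neutral) fastforce
  moreover have "w \<in> V" "real (S w) = real d + real r" using w by auto
  ultimately show ?thesis
    using secant_gap[OF fin, of w "\<lambda>v. real (S v)" d r f D] by simp
qed

section \<open>Convexity and concavity of powers\<close>

lemma powr_second_derivative:
  fixes a x :: real
  assumes "x > 0"
  shows "((\<lambda>x. x powr a) has_real_derivative a * x powr (a - 1)) (at x)"
    and "((\<lambda>x. a * x powr (a - 1)) has_real_derivative a * (a - 1) * x powr (a - 2)) (at x)"
  using assms by (auto intro!: derivative_eq_intros)

lemma convex_on_powr: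
  fixes a :: real
  assumes "a < 0 \<or> a > 1"
  shows "convex_on {0<..} (\<lambda>x. x powr a)"
  using assms
  by (intro f''_ge0_imp_convex[OF _ powr_second_derivative]) (auto simp: zero_le_mult_iff)

lemma concave_on_powr:
  fixes a :: real
  assumes "0 < a" "a < 1"
  shows "concave_on {0<..} (\<lambda>x. x powr a)"
  using assms
  by (intro f''_le0_imp_concave[OF _ powr_second_derivative]) (auto simp: mult_le_0_iff)

section \<open>The bounds\<close>

theorem theorem3p12:
  fixes V :: "'a set" and E :: "'a set set"
    and n m M1 \<delta> \<Delta> q r :: nat and N :: "nat \<Rightarrow> nat" and a s :: real
  assumes "simple_graph V E" and "connected_graph V E"
    and "n = card V" and "n \<ge> 3" and "m = card E"
    and "N = num_edge_nbhd_degree V E"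
    and "\<delta> = min_edge_nbhd_degree V E" and "\<Delta> = max_edge_nbhd_degree V E"
    and "M1 = first_zagreb V E"
    and "\<Delta> - \<delta> \<ge> 2"
    and "2 * int M1 - 4 * int m - int n * int \<delta> = int q * (int \<Delta> - int \<delta>) + int r"
    and "q > 0" and "r \<le> \<Delta> - \<delta> - 1"
    and "a \<noteq> 0" and "a \<noteq> 1"
    and "s = (real \<Delta> powr a - real \<delta> powr a) / (real \<Delta> - real \<delta>)"
  shows
    "(r = 0 \<and> N \<Delta> = q \<longrightarrow> bi_edge_nbhd_degree_graph V E \<delta> \<Delta>)
   \<and> (r \<ge> 1 \<and> N \<Delta> = q \<longrightarrow>
        (\<forall>i. \<delta> + r + 1 \<le> i \<and> i \<le> \<Delta> - 1 \<longrightarrow> N i = 0) \<and> N (\<delta> + r) \<le> 1)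
   \<and> (r \<ge> 1 \<and> (a < 0 \<or> a > 1) \<and> N (\<delta> + r) \<noteq> 0 \<longrightarrow>
        kulli_basava a V E \<le>
          real n * real \<delta> powr a + (2 * real M1 - 4 * real m - real n * real \<delta>) * s
          + real (\<delta> + r) powr a - real \<delta> powr a - real r * s
        \<and> (N \<Delta> = q \<and> N (\<delta> + r) = 1 \<and> int (N \<delta>) = int n - int q - 1 \<longrightarrow>
            kulli_basava a V E =
              real n * real \<delta> powr a + (2 * real M1 - 4 * real m - real n * real \<delta>) * s
              + real (\<delta> + r) powr a - real \<delta> powr a - real r * s))
   \<and> (r \<ge> 1 \<and> 0 < a \<and> a < 1 \<and> N (\<delta> + r) \<noteq> 0 \<longrightarrow>
        kulli_basava a V E \<ge>
          real n * real \<delta> powr a + (2 * real M1 - 4 * real m - real n * real \<delta>) * s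
          + real (\<delta> + r) powr a - real \<delta> powr a - real r * s
        \<and> (N \<Delta> = q \<and> N (\<delta> + r) = 1 \<and> int (N \<delta>) = int n - int q - 1 \<longrightarrow>
            kulli_basava a V E =
              real n * real \<delta> powr a + (2 * real M1 - 4 * real m - real n * real \<delta>) * s
              + real (\<delta> + r) powr a - real \<delta> powr a - real r * s))
   \<and> (r \<ge> 1 \<and> a > 1 \<and> N (\<delta> + r) \<noteq> 0 \<longrightarrow>
        ln (mult_kulli_basava a V E) \<ge>
          a * (real n * ln (real \<delta>)
            + (2 * real M1 - 4 * real m - real n * real \<delta>) * (ln (real \<Delta>) - ln (real \<delta>))
                / (real \<Delta> - real \<delta>)
            + ln (real (\<delta> + r)) - ln (real \<delta>)
            - real r * ((ln (real \<Delta>) - ln (real \<delta>)) / (real \<Delta> - real \<delta>)))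
        \<and> (N \<Delta> = q \<and> N (\<delta> + r) = 1 \<and> int (N \<delta>) = int n - int q - 1 \<longrightarrow>
            ln (mult_kulli_basava a V E) =
              a * (real n * ln (real \<delta>)
                + (2 * real M1 - 4 * real m - real n * real \<delta>) * (ln (real \<Delta>) - ln (real \<delta>))
                    / (real \<Delta> - real \<delta>)
                + ln (real (\<delta> + r)) - ln (real \<delta>)
                - real r * ((ln (real \<Delta>) - ln (real \<delta>)) / (real \<Delta> - real \<delta>)))))"
proof -
  let ?S = "edge_nbhd_degree E"
  note G = assms(1)
  have fin: "finite V" using G by (simp add: simple_graph_def)
  have ne: "V \<noteq> {}" using assms(3,4) by auto
  have range: "\<delta> \<le> ?S v \<and> ?S v \<le> \<Delta>" if "v \<in> V" for v
    using that fin assms(7,8) by (simp add: min_edge_nbhd_degree_def max_edge_nbhd_degree_def)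
  have "\<delta> \<in> ?S ` V"
    unfolding assms(7) min_edge_nbhd_degree_def using fin ne by (intro Min_in) auto
  then have pos: "\<delta> > 0" using edge_nbhd_degree_pos[OF G assms(2)] assms(3,4) by auto
  have S_pos: "?S v > 0" if "v \<in> V" for v using range[OF that] pos by simp
  have N: "N i = card {v \<in> V. ?S v = i}" for i
    by (simp add: assms(6) num_edge_nbhd_degree_def)
  have \<Delta>: "\<delta> + r < \<Delta>" using assms(10,13) by linarith
  have sum: "(\<Sum>v\<in>V. int (?S v)) = 2 * int M1 - 4 * int m"
    using sum_edge_nbhd_degree[OF G] assms(5,9) by simp
  have real_sum: "(\<Sum>v\<in>V. real (?S v)) = 2 * real M1 - 4 * real m"
  proof -
    have "(\<Sum>v\<in>V. real (?S v)) = real_of_int (\<Sum>v\<in>V. int (?S v))" by simp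
    then show ?thesis by (simp only: sum of_int_diff of_int_mult of_int_of_nat_eq of_int_numeral)
  qed

  have excess: "(\<Sum>v | v \<in> V \<and> ?S v \<noteq> \<Delta>. ?S v - \<delta>) = r" if "N \<Delta> = q"
    using range sum assms(3,11) that by (intro sum_excess_below_max[OF fin]) (auto simp: N)
  have excess_le: "?S v \<le> \<delta> + r" if "N \<Delta> = q" "v \<in> V" "?S v \<noteq> \<Delta>" for v
  proof -
    have "?S v - \<delta> \<le> (\<Sum>v | v \<in> V \<and> ?S v \<noteq> \<Delta>. ?S v - \<delta>)"
      using fin that by (intro member_le_sum) auto
    then show ?thesis using excess[OF that(1)] by simp
  qed

  have part1: "bi_edge_nbhd_degree_graph V E \<delta> \<Delta>" if "r = 0" "N \<Delta> = q"
    using excess_le[OF that(2)] range that(1)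
    by (fastforce simp: bi_edge_nbhd_degree_graph_def intro: antisym)

  have part2: "(\<forall>i. \<delta> + r + 1 \<le> i \<and> i \<le> \<Delta> - 1 \<longrightarrow> N i = 0) \<and> N (\<delta> + r) \<le> 1"
    if r: "r \<ge> 1" and q: "N \<Delta> = q"
  proof (intro conjI allI impI)
    fix i assume "\<delta> + r + 1 \<le> i \<and> i \<le> \<Delta> - 1"
    then have "{v \<in> V. ?S v = i} = {}" using excess_le[OF q] \<Delta> by fastforce
    then show "N i = 0" by (simp only: N card.empty)
  next
    have "N (\<delta> + r) * r = (\<Sum>v | v \<in> V \<and> ?S v = \<delta> + r. ?S v - \<delta>)"
      by (simp add: N)
    also have "\<dots> \<le> (\<Sum>v | v \<in> V \<and> ?S v \<noteq> \<Delta>. ?S v - \<delta>)"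
      using fin \<Delta> by (intro sum_mono2) auto
    finally show "N (\<delta> + r) \<le> 1" using excess[OF q] r by simp
  qed

  let ?T = "2 * real M1 - 4 * real m"
  have witness: "\<exists>w\<in>V. real (?S w) = real \<delta> + real r" if "N (\<delta> + r) \<noteq> 0"
  proof -
    have "{v \<in> V. ?S v = \<delta> + r} \<noteq> {}" using that unfolding N by (metis card.empty)
    then show ?thesis by force
  qed
  have sub: "{real \<delta>..real \<Delta>} \<subseteq> {0<..}" using pos by auto
  have upper: "(\<Sum>v\<in>V. f (real (?S v))) \<le> secant_sum f \<delta> \<Delta> r n ?T"
    if f: "convex_on {0<..} f" and N0: "N (\<delta> + r) \<noteq> 0" for f
  proof -
    obtain w where w: "w \<in> V" "real (?S w) = real \<delta> + real r" using witness[OF N0] by blast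
    have "convex_on {real \<delta>..real \<Delta>} f" by (rule convex_on_subset[OF f sub]) simp
    then show ?thesis
      using convex_sum_le_secant_sum[of V w "\<lambda>v. real (?S v)" \<delta> r \<Delta> f] fin w range
      by (simp add: real_sum assms(3))
  qed
  have lower: "(\<Sum>v\<in>V. f (real (?S v))) \<ge> secant_sum f \<delta> \<Delta> r n ?T"
    if f: "concave_on {0<..} f" and N0: "N (\<delta> + r) \<noteq> 0" for f
  proof -
    obtain w where w: "w \<in> V" "real (?S w) = real \<delta> + real r" using witness[OF N0] by blast
    have "concave_on {real \<delta>..real \<Delta>} f"
      using f convex_on_subset[OF _ sub] by (simp add: concave_on_def)
    then show ?thesis
      using concave_sum_ge_secant_sum[of V w "\<lambda>v. real (?S v)" \<delta> r \<Delta> f] fin w range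
      by (simp add: real_sum assms(3))
  qed
  have equal: "(\<Sum>v\<in>V. f (real (?S v))) = secant_sum f \<delta> \<Delta> r n ?T"
    if "r \<ge> 1" "N \<Delta> = q" "N (\<delta> + r) = 1" "int (N \<delta>) = int n - int q - 1" for f
    using sum_eq_secant_sum[OF fin that(1) \<Delta>, of ?S q f] that real_sum assms(3)
    by (simp add: N)

  have power_secant: "secant_sum (\<lambda>x. x powr a) \<delta> \<Delta> r n ?T
      = real n * real \<delta> powr a + (2 * real M1 - 4 * real m - real n * real \<delta>) * s
          + real (\<delta> + r) powr a - real \<delta> powr a - real r * s"
    by (simp add: secant_sum_def assms(16))
  have ln_secant: "secant_sum ln \<delta> \<Delta> r n ?T
      = real n * ln (real \<delta>)
            + (2 * real M1 - 4 * real m - real n * real \<delta>) * (ln (real \<Delta>) - ln (real \<delta>))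
                / (real \<Delta> - real \<delta>)
            + ln (real (\<delta> + r)) - ln (real \<delta>)
            - real r * ((ln (real \<Delta>) - ln (real \<delta>)) / (real \<Delta> - real \<delta>))"
    by (simp add: secant_sum_def)
  have ln_product: "ln (mult_kulli_basava a V E) = a * (\<Sum>v\<in>V. ln (real (?S v)))"
  proof -
    have "ln (mult_kulli_basava a V E) = (\<Sum>v\<in>V. ln (real (?S v) powr a))"
      unfolding mult_kulli_basava_def using S_pos by (intro ln_prod[OF fin]) fastforce
    also have "\<dots> = (\<Sum>v\<in>V. a * ln (real (?S v)))"
      using S_pos by (intro sum.cong) (auto simp: ln_powr)
    finally show ?thesis by (simp add: sum_distrib_left)
  qed

  show ?thesis
    unfolding power_secant[symmetric] ln_secant[symmetric] ln_product kulli_basava_def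
    using part1 part2 upper[OF convex_on_powr] lower[OF concave_on_powr] lower[OF ln_concave]
      equal[of "\<lambda>x. x powr a"] equal[of ln]
    by (auto intro!: mult_left_mono)
qed

end
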